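(* The following two statements (1) and (2), about number fields $\mathbb{K}_1\subseteq\mathbb{K}$ with $m=[\mathbb{K}:\mathbb{K}_1]$ and a prime number $p$, are not equivalent in general; that is, there exist number fields $\mathbb{K}_1\subseteq\mathbb{K}$ and a prime $p$ for which exactly one of them holds: (1) $m\,v_p(i(\mathbb{K}_1))=v_p(i(\mathbb{K}))$. (2) For every algebraic integer $\beta$ of $\mathbb{K}$, if $v_p(i(\beta))=v_p(i(\mathbb{K}))$, then there exists an algebraic integer $\alpha$ of $\mathbb{K}_1$ such that $\beta\equiv\alpha \pmod p$.
   Context: Here $v_p$ is the $p$-adic valuation, and $\beta\equiv\alpha\pmod p$ means $\beta-\alpha\in p\mathbb{A}$ with $\mathbb{A}$ the ring of integers of $\mathbb{K}$. For a number field $\mathbb{K}$ of degree $n$ over $\mathbb{Q}$ with ring of integers $\mathbb{A}$, let $\widehat{\mathbb{A}}$ be the set of $\theta\in\mathbb{A}$ that are primitive over $\mathbb{Q}$, i.e. $\mathbb{K}=\mathbb{Q}(\theta)$. For $\theta\in\mathbb{A}$ let $F_\theta(x)\in\mathbb{Z}[x]$ be the (degree $n$) characteristic polynomial of $\theta$ over $\mathbb{Q}$ (relative to the extension $\mathbb{K}/\mathbb{Q}$) and set $i(\theta)=\gcd_{x\in\mathbb{Z}}F_\theta(x)$. Define $i(\mathbb{K})=\operatorname{lcm}_{\theta\in\widehat{\mathbb{A}}}\, i(\theta)$; $i(\mathbb{K}_1)$ is defined in the same way for the field $\mathbb{K}_1$. *)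

theory Defs
  imports
    "HOL-Algebra.Algebraic_Closure_Type"
    "HOL-Algebra.Generated_Fields"
    "HOL-Algebra.Embedded_Algebras"
    "Jordan_Normal_Form.Char_Poly"
begin

text \<open>
  Number fields are taken inside the complex numbers: every number field, and every pair
  consisting of a number field and a subfield, embeds there.
\<close>

abbreviation complex_ring :: "complex ring" where
  "complex_ring \<equiv> ring_of_type_algebra"

definition number_field :: "complex set \<Rightarrow> bool" where
  "number_field K \<longleftrightarrow> subfield K complex_ring \<and> ring.finite_dimension complex_ring \<rat> K"

definition field_degree :: "complex set \<Rightarrow> complex set \<Rightarrow> nat" where
  "field_degree K K\<^sub>1 = ring.dim complex_ring K\<^sub>1 K"

definition ring_of_integers :: "complex set \<Rightarrow> complex set" where
  "ring_of_integers K = {\<theta> \<in> K. algebraic_int \<theta>}"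

definition primitive_integers :: "complex set \<Rightarrow> complex set" where
  "primitive_integers K =
     {\<theta> \<in> ring_of_integers K. generate_field complex_ring (insert \<theta> \<rat>) = K}"

definition rat_basis :: "complex set \<Rightarrow> complex list \<Rightarrow> bool" where
  "rat_basis K bs \<longleftrightarrow>
     set bs \<subseteq> K \<and> ring.independent complex_ring \<rat> bs \<and> ring.Span complex_ring \<rat> bs = K"

definition is_mult_matrix :: "complex list \<Rightarrow> complex \<Rightarrow> rat mat \<Rightarrow> bool" where
  "is_mult_matrix bs \<theta> M \<longleftrightarrow>
     M \<in> carrier_mat (length bs) (length bs) \<and>
     (\<forall>j<length bs. \<theta> * bs ! j = (\<Sum>i<length bs. of_rat (M $$ (i, j)) * bs ! i))"

text \<open>
  The characteristic polynomial of \<open>\<theta>\<close> relative to \<open>K\<close> over the rationals, i.e. that of the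
  rational linear map given by multiplication by \<open>\<theta>\<close> on \<open>K\<close>. It does not depend on the basis,
  and for \<open>\<theta>\<close> in the ring of integers of \<open>K\<close> its coefficients are integers; elsewhere the
  value is irrelevant.
\<close>

definition field_char_poly :: "complex set \<Rightarrow> complex \<Rightarrow> int poly" where
  "field_char_poly K \<theta> =
     (THE F. \<exists>bs M. rat_basis K bs \<and> is_mult_matrix bs \<theta> M \<and> map_poly of_int F = char_poly M)"

definition int_index :: "complex set \<Rightarrow> complex \<Rightarrow> int" where
  "int_index K \<theta> = (GCD x. poly (field_char_poly K \<theta>) x)"

text \<open>
  \<^term>\<open>Lcm\<close> of an unbounded set of integers is \<open>0\<close>. This case does not arise below:
  \<open>F\<^sub>\<theta>\<close> is monic of degree \<open>n = [K : \<rat>]\<close>, so taking \<open>n\<close>-th differences shows that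
  \<open>i(\<theta>)\<close> divides \<open>n!\<close>.
\<close>

definition field_index :: "complex set \<Rightarrow> int" where
  "field_index K = (LCM \<theta>\<in>primitive_integers K. int_index K \<theta>)"

definition cong_integers :: "complex set \<Rightarrow> nat \<Rightarrow> complex \<Rightarrow> complex \<Rightarrow> bool" where
  "cong_integers K p \<beta> \<alpha> \<longleftrightarrow> (\<exists>\<gamma>\<in>ring_of_integers K. \<beta> - \<alpha> = of_nat p * \<gamma>)"

definition index_power_condition :: "complex set \<Rightarrow> complex set \<Rightarrow> nat \<Rightarrow> bool" where
  "index_power_condition K\<^sub>1 K p \<longleftrightarrow>
     field_degree K K\<^sub>1 * multiplicity (int p) (field_index K\<^sub>1) =
     multiplicity (int p) (field_index K)"

definition index_cong_condition :: "complex set \<Rightarrow> complex set \<Rightarrow> nat \<Rightarrow> bool" where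
  "index_cong_condition K\<^sub>1 K p \<longleftrightarrow>
     (\<forall>\<beta>\<in>ring_of_integers K.
        multiplicity (int p) (int_index K \<beta>) = multiplicity (int p) (field_index K) \<longrightarrow>
        (\<exists>\<alpha>\<in>ring_of_integers K\<^sub>1. cong_integers K p \<beta> \<alpha>))"

end

(*
  Counterexample: K1 = Q, K = Q(i), p = 3. Second differences of a monic quadratic equal 2, so
  i(\<theta>) divides 2 for every primitive integer of K. Hence 3 divides neither i(K1) nor i(K), and
  (1) reads 0 = 0. The hypothesis of (2) then holds for \<beta> = i, but i = n + 3 \<gamma> would give \<gamma> the
  norm (n^2 + 1) / 9, which is not an integer since -1 is not a square modulo 3.
*)
theory Submission
  imports Defs
begin

section \<open>Nonreal algebraic integers of degree two\<close>

text \<open>A Gauss lemma argument: a nonreal number has no nonzero linear integer relation, so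
  pseudo-division by \<open>Q\<close> of a monic \<open>P\<close> killing \<theta> leaves remainder
  0. Comparing contents then makes \<open>Q\<close> a divisor of \<open>P\<close> over the
  integers.\<close>

lemma algebraic_int_nonreal_primitive_quadratic:
  fixes \<theta> :: complex and Q :: "int poly"
  assumes int: "algebraic_int \<theta>" and nonreal: "Im \<theta> \<noteq> 0"
    and deg: "degree Q = 2" and prim: "content Q = 1"
    and root: "poly (map_poly of_int Q) \<theta> = 0"
  shows "lead_coeff Q dvd 1"
proof -
  from int obtain P :: "int poly"
    where P: "poly (map_poly of_int P) \<theta> = 0" "lead_coeff P = 1"
    by (auto simp: algebraic_int_altdef_ipoly)
  have Q0: "Q \<noteq> 0" using deg by auto
  define S where "S = pseudo_mod P Q"
  from pseudo_mod(1)[OF Q0, of P] obtain c R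
    where c: "c \<noteq> 0" and eq: "smult c P = Q * R + S"
    unfolding S_def by auto
  have S: "degree S \<le> 1"
    using pseudo_mod(2)[OF Q0, of P] deg unfolding S_def by auto
  have "poly (map_poly of_int (smult c P)) \<theta> =
      poly (map_poly of_int Q) \<theta> * poly (map_poly of_int R) \<theta> + poly (map_poly of_int S) \<theta>"
    unfolding eq by (simp add: of_int_poly_hom.hom_mult of_int_poly_hom.hom_add)
  hence S_root: "poly (map_poly of_int S) \<theta> = 0"
    using P(1) root by (simp add: of_int_hom.map_poly_hom_smult)
  have "S = [:coeff S 0, coeff S 1:]"
    using S by (intro poly_eqI) (auto simp: coeff_pCons coeff_eq_0 split: nat.splits)
  then obtain u v where uv: "S = [:u, v:]" by blast
  have "of_int u + \<theta> * of_int v = 0" using S_root by (simp add: uv of_int_hom.map_poly_pCons_hom)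
  \<comment> \<open>The imaginary part forces \<open>v = 0\<close>, after which the real part forces
    \<open>u = 0\<close>.\<close>
  from arg_cong[OF this, of Im] arg_cong[OF this, of Re] nonreal have "S = 0"
    by (auto simp: uv)
  hence eq: "smult c P = Q * R" using eq by simp
  \<comment> \<open>\<open>P\<close> and \<open>Q\<close> both have content 1, so the content of
    \<open>R\<close> is \<open>c\<close> up to sign; hence \<open>c\<close> can be cancelled from
    \<open>smult c P = Q * R\<close>.\<close>
  have "content P dvd lead_coeff P" by (rule content_dvd_coeff)
  hence "content P = 1" using P(2) by (metis is_unit_normalize normalize_content)
  hence "content R = normalize c"
    using arg_cong[OF eq, of content] prim by (simp add: content_mult)
  hence "c dvd content R" by simp
  hence "[:c:] dvd R" by (simp add: const_poly_dvd_iff_dvd_content)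
  then obtain R' where "R = smult c R'" by (auto elim!: dvdE)
  hence "P = Q * R'" using eq c by (simp add: smult_cancel)
  thus ?thesis using P(2) by (metis dvd_triv_left lead_coeff_mult)
qed

text \<open>Integrality of trace and norm: \<theta> is a root of x^2 - 2 Re(\<theta>) x +
  |\<theta>|^2, and the primitive integer multiple of this polynomial has leading coefficient 1 or
  -1 by the preceding lemma.\<close>

lemma algebraic_int_nonreal_quadratic:
  fixes \<theta> :: complex
  assumes int: "algebraic_int \<theta>" and nonreal: "Im \<theta> \<noteq> 0"
    and rat: "Re \<theta> \<in> \<rat>" "Im \<theta> \<in> \<rat>"
  obtains s t :: int where "2 * Re \<theta> = of_int s" "(Re \<theta>)\<^sup>2 + (Im \<theta>)\<^sup>2 = of_int t"
proof -
  from rat have "2 * Re \<theta> \<in> \<rat>" "(Re \<theta>)\<^sup>2 + (Im \<theta>)\<^sup>2 \<in> \<rat>" by auto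
  then obtain a b c d :: int where b: "b > 0" "2 * Re \<theta> = of_int a / of_int b"
    and d: "d > 0" "(Re \<theta>)\<^sup>2 + (Im \<theta>)\<^sup>2 = of_int c / of_int d"
    by (auto elim!: Rats_cases')
  \<comment> \<open>The quadratic with roots \<theta> and its conjugate, multiplied by the common
    denominator \<open>b * d\<close>.\<close>
  define Q0 where "Q0 = [:b * c, - (a * d), b * d:]"
  define Q where "Q = primitive_part Q0"
  have "b * d \<noteq> 0" using b d by auto
  hence deg0: "degree Q0 = 2" by (simp add: Q0_def)
  hence deg: "degree Q = 2" and prim: "content Q = 1"
    by (auto simp: Q_def intro!: content_primitive_part)
  have c0: "content Q0 \<noteq> 0" using deg0 by auto
  have quad: "\<theta>\<^sup>2 - of_real (2 * Re \<theta>) * \<theta> + of_real ((Re \<theta>)\<^sup>2 + (Im \<theta>)\<^sup>2) = 0"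
    by (auto simp: complex_eq_iff power2_eq_square algebra_simps)
  have "poly (map_poly of_int Q0) \<theta> =
      of_int (b * d) * (\<theta>\<^sup>2 - of_real (2 * Re \<theta>) * \<theta> + of_real ((Re \<theta>)\<^sup>2 + (Im \<theta>)\<^sup>2))"
    using b(1) d(1) unfolding b(2) d(2) Q0_def
    by (simp add: power2_eq_square field_simps)
  hence "poly (map_poly of_int Q0) \<theta> = 0" using quad by simp
  moreover have "Q0 = smult (content Q0) Q" by (simp add: Q_def)
  ultimately have root: "poly (map_poly of_int Q) \<theta> = 0"
    using c0 by (metis mult_eq_0_iff of_int_eq_0_iff of_int_hom.map_poly_hom_smult poly_smult)
  have unit: "lead_coeff Q dvd 1"
    using algebraic_int_nonreal_primitive_quadratic[OF int nonreal deg prim root] .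
  define e where "e = coeff Q 2"
  have e: "e * e = 1" using unit deg abs_mult_self_eq[of e] by (simp add: e_def)
  have "Q = [:coeff Q 0, coeff Q 1, e:]"
    using deg unfolding e_def
    by (intro poly_eqI) (auto simp: coeff_pCons coeff_eq_0 numeral_2_eq_2 split: nat.splits)
  then obtain u v where uv: "Q = [:u, v, e:]" by blast
  \<comment> \<open>Since \<open>e * e = 1\<close>, multiplying by \<open>e\<close> makes the
    relation monic; its imaginary and real parts then give trace and norm.\<close>
  have "of_int e * (of_int u + \<theta> * (of_int v + \<theta> * of_int e)) = 0"
    using root e by (auto simp: uv of_int_hom.map_poly_pCons_hom)
  hence eq: "of_int (e * u) + \<theta> * of_int (e * v) + \<theta> * \<theta> * of_int (e * e) = 0"
    by (simp add: algebra_simps)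
  have "Im \<theta> * (of_int (e * v) + 2 * Re \<theta>) = 0"
    using arg_cong[OF eq, of Im] unfolding e by (simp add: algebra_simps)
  hence s: "2 * Re \<theta> = of_int (- (e * v))" using nonreal by simp
  have "of_int (e * u) + Re \<theta> * of_int (e * v) + (Re \<theta> * Re \<theta> - Im \<theta> * Im \<theta>) = 0"
    using arg_cong[OF eq, of Re] unfolding e by simp
  moreover have "of_int (e * v) = - 2 * Re \<theta>" using s by simp
  ultimately have "(Re \<theta>)\<^sup>2 + (Im \<theta>)\<^sup>2 = of_int (e * u)"
    by (simp add: power2_eq_square algebra_simps)
  with s show thesis by (rule that)
qed

section \<open>The complex numbers as an algebraic structure\<close>

interpretation C: cring complex_ring
  by (rule cring_from_type_algebra)

lemma complex_ring_simps [simp]: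
  "carrier complex_ring = UNIV" "x \<otimes>\<^bsub>complex_ring\<^esub> y = x * y" "\<one>\<^bsub>complex_ring\<^esub> = 1"
  "x \<oplus>\<^bsub>complex_ring\<^esub> y = x + y" "\<zero>\<^bsub>complex_ring\<^esub> = 0"
  by (simp_all add: ring_of_type_algebra_def)

lemma complex_ring_a_inv [simp]: "\<ominus>\<^bsub>complex_ring\<^esub> x = - x"
  using C.minus_equality[of "- x" x] by simp

lemma complex_ring_m_inv: "x \<noteq> 0 \<Longrightarrow> inv\<^bsub>complex_ring\<^esub> x = inverse x"
  using C.comm_inv_char[of x "inverse x"] by simp

text \<open>Closure under \<open>inverse\<close> can be stated without excluding 0 because
  \<open>inverse 0 = 0\<close>.\<close>

lemma complex_subfieldI:
  assumes "1 \<in> K" "\<And>x. x \<in> K \<Longrightarrow> - x \<in> K" "\<And>x y. x \<in> K \<Longrightarrow> y \<in> K \<Longrightarrow> x * y \<in> K"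
    "\<And>x y. x \<in> K \<Longrightarrow> y \<in> K \<Longrightarrow> x + y \<in> K" "\<And>x. x \<in> K \<Longrightarrow> inverse x \<in> K"
  shows "subfield K complex_ring"
  using assms by (intro field.subfieldI'[OF field_from_type_algebra] C.subringI)
    (auto simp: complex_ring_m_inv)

lemma subfield_Rats: "subfield \<rat> complex_ring"
  by (rule complex_subfieldI) auto

lemma rat_basis_imp_number_field:
  assumes "subfield K complex_ring" "rat_basis K bs"
  shows "number_field K"
proof -
  have "C.dimension (length bs) \<rat> K"
    using assms(2) C.dimensionI[OF subfield_Rats] by (auto simp: rat_basis_def)
  thus ?thesis using assms(1) by (auto simp: number_field_def intro: C.finite_dimensionI)
qed

text \<open>Fixes the degree of every candidate polynomial in the definite description of
  \<open>field_char_poly\<close>.\<close>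

lemma rat_basis_length:
  assumes "rat_basis K bs" "rat_basis K bs'"
  shows "length bs = length bs'"
proof -
  have "C.dimension (length bs) \<rat> K" "C.dimension (length bs') \<rat> K"
    using assms C.dimensionI[OF subfield_Rats] by (auto simp: rat_basis_def)
  thus ?thesis by (rule C.dimension_is_inj[OF subfield_Rats])
qed

section \<open>Characteristic polynomials\<close>

lemma det_2:
  fixes A :: "'a :: comm_ring_1 mat"
  assumes A: "A \<in> carrier_mat 2 2"
  shows "det A = A $$ (0, 0) * A $$ (1, 1) - A $$ (0, 1) * A $$ (1, 0)"
proof -
  have "mat_delete A 0 j \<in> carrier_mat 1 1" for j
    using mat_delete_carrier[OF A] by simp
  thus ?thesis
    using A laplace_expansion_row[OF A, of 0]
    by (simp add: cofactor_def det_single mat_delete_def numeral_2_eq_2 lessThan_Suc)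
qed

text \<open>A nonempty basis, read as a row vector, is a left eigenvector for the eigenvalue \<open>\<theta>\<close>.\<close>

lemma char_poly_mult_matrix_root:
  assumes basis: "rat_basis K bs" and M: "is_mult_matrix bs \<theta> M" and ne: "bs \<noteq> []"
  shows "poly (map_poly of_rat (char_poly M)) \<theta> = 0"
proof -
  let ?n = "length bs"
  define A where "A = map_mat (of_rat :: rat \<Rightarrow> complex) M"
  have Mc: "M \<in> carrier_mat ?n ?n" using M by (simp add: is_mult_matrix_def)
  hence A: "A \<in> carrier_mat ?n ?n" by (simp add: A_def)
  from ne obtain b bs' where bs: "bs = b # bs'" by (cases bs) auto
  have "b \<notin> C.Span \<rat> bs'"
    using basis C.independent_backwards(1) unfolding rat_basis_def bs by blast
  hence "b \<noteq> 0" using C.Span_subgroup_props(2)[OF subfield_Rats, of bs'] by auto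
  hence nz: "vec_of_list bs \<noteq> 0\<^sub>v ?n"
    by (metis bs index_zero_vec(1) length_greater_0_conv list.distinct(1) nth_Cons_0
        vec_of_list_index)
  \<comment> \<open>The columns of \<open>M\<close> hold the coordinates of the products of \<theta>
    with the basis elements, hence the transpose, which has the same characteristic
    polynomial.\<close>
  have "transpose_mat A *\<^sub>v vec_of_list bs = \<theta> \<cdot>\<^sub>v vec_of_list bs"
    using M A Mc unfolding is_mult_matrix_def A_def
    by (intro eq_vecI)
      (auto simp: scalar_prod_def vec_of_list_index atLeast0LessThan intro!: sum.cong)
  hence "eigenvalue (transpose_mat A) \<theta>"
    using A nz unfolding eigenvalue_def eigenvector_def
    by (intro exI[of _ "vec_of_list bs"]) (auto intro: carrier_vecI)
  moreover have "transpose_mat A \<in> carrier_mat ?n ?n" using A by simp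
  ultimately have "poly (char_poly A) \<theta> = 0"
    using eigenvalue_root_char_poly char_poly_transpose_mat[OF A] by metis
  thus ?thesis by (simp add: A_def of_rat_hom.char_poly_hom[OF Mc])
qed

text \<open>The last hypothesis says that \<open>F\<close> is the minimal polynomial of \<open>\<theta>\<close>, so the lemma applies to
  primitive \<open>\<theta>\<close> only; it makes the independence of the basis immediate.\<close>

lemma field_char_poly_eqI:
  assumes basis: "rat_basis K bs" and M: "is_mult_matrix bs \<theta> M"
    and F: "map_poly of_int F = char_poly M" and ne: "bs \<noteq> []"
    and unique: "\<And>G. lead_coeff G = 1 \<Longrightarrow> degree G = length bs \<Longrightarrow>
      poly (map_poly of_int G) \<theta> = 0 \<Longrightarrow> G = F"
  shows "field_char_poly K \<theta> = F"
  unfolding field_char_poly_def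
proof (rule the_equality)
  show "\<exists>bs M. rat_basis K bs \<and> is_mult_matrix bs \<theta> M \<and> map_poly of_int F = char_poly M"
    using basis M F by blast
next
  fix G
  assume "\<exists>bs M. rat_basis K bs \<and> is_mult_matrix bs \<theta> M \<and> map_poly of_int G = char_poly M"
  then obtain bs' M' where *: "rat_basis K bs'" "is_mult_matrix bs' \<theta> M'"
    and G: "map_poly of_int G = char_poly M'" by blast
  have len: "length bs' = length bs" using rat_basis_length[OF *(1) basis] .
  hence ne': "bs' \<noteq> []" using ne by auto
  have M': "M' \<in> carrier_mat (length bs) (length bs)"
    using *(2) len by (simp add: is_mult_matrix_def)
  have deg: "degree G = length bs"
    using degree_monic_char_poly[OF M'] by (simp flip: G)
  have lead: "lead_coeff G = 1"
    using degree_monic_char_poly[OF M'] deg by (simp flip: G)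
  \<comment> \<open>\<open>char_poly M'\<close> is rational, so the root statement for it reaches
    the integer polynomial \<open>G\<close> only through this change of coefficients.\<close>
  have "map_poly of_rat (map_poly of_int G :: rat poly) = (map_poly of_int G :: complex poly)"
    by (subst map_poly_map_poly) (auto simp: o_def)
  hence "poly (map_poly of_int G) \<theta> = 0"
    using char_poly_mult_matrix_root[OF * ne'] by (simp flip: G)
  with lead deg show "G = F" by (rule unique)
qed

section \<open>The rational numbers\<close>

lemma rat_basis_Rats: "rat_basis \<rat> [1]"
  unfolding rat_basis_def
  by (auto simp: C.line_extension_mem_iff intro!: C.li_Cons)

lemma field_char_poly_Rats: "field_char_poly \<rat> (of_int n) = [:- n, 1:]"
proof (rule field_char_poly_eqI[OF rat_basis_Rats])
  define M :: "rat mat" where "M = mat 1 1 (\<lambda>_. of_int n)"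
  show "is_mult_matrix [1] (of_int n) M" by (auto simp: is_mult_matrix_def M_def)
  show "map_poly of_int [:- n, 1:] = char_poly M"
    by (simp add: char_poly_defs M_def det_single)
next
  fix G :: "int poly"
  assume G: "lead_coeff G = 1" "degree G = length [1::complex]"
    "poly (map_poly of_int G) (of_int n :: complex) = 0"
  have "G = [:coeff G 0, 1:]"
    using G by (intro poly_eqI) (auto simp: coeff_pCons coeff_eq_0 split: nat.splits)
  then obtain u where u: "G = [:u, 1:]" by blast
  have "(of_int (u + n) :: complex) = 0" using G(3) by (simp add: u)
  hence "u + n = 0" by (simp only: of_int_eq_0_iff)
  thus "G = [:- n, 1:]" by (simp add: u)
qed simp

lemma int_index_Rats:
  assumes "\<theta> \<in> ring_of_integers \<rat>"
  shows "int_index \<rat> \<theta> = 1"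
proof -
  from assms obtain n where n: "\<theta> = of_int n"
    using rational_algebraic_int_is_int[of \<theta>] by (auto simp: ring_of_integers_def elim: Ints_cases)
  \<comment> \<open>The polynomial is x - n, with value 1 at \<open>n + 1\<close>.\<close>
  have "int_index \<rat> \<theta> dvd poly (field_char_poly \<rat> \<theta>) (n + 1)"
    unfolding int_index_def by (rule Gcd_dvd) auto
  hence "int_index \<rat> \<theta> dvd 1" by (simp add: n field_char_poly_Rats)
  moreover have "int_index \<rat> \<theta> \<ge> 0" by (simp add: int_index_def)
  ultimately show ?thesis by simp
qed

lemma field_index_Rats_dvd: "field_index \<rat> dvd 1"
  unfolding field_index_def
  by (rule Lcm_least) (auto simp: int_index_Rats primitive_integers_def)

section \<open>The Gaussian rationals\<close>

text \<open>The field Q(i), given by coordinates so that closure and membership reduce to statements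
  about real and imaginary parts.\<close>

definition gaussian_rationals :: "complex set" where
  "gaussian_rationals = {z. Re z \<in> \<rat> \<and> Im z \<in> \<rat>}"

lemma of_rat_complex_eq: "(of_rat q :: complex) = of_real (of_rat q)"
  by (cases q) (simp add: of_rat_rat)

lemma complex_Rats_iff: "z \<in> \<rat> \<longleftrightarrow> Re z \<in> \<rat> \<and> Im z = 0"
proof
  assume "z \<in> \<rat>"
  then obtain q where "z = of_rat q" by (auto elim: Rats_cases)
  thus "Re z \<in> \<rat> \<and> Im z = 0" by (simp add: of_rat_complex_eq)
next
  assume *: "Re z \<in> \<rat> \<and> Im z = 0"
  then obtain q where "Re z = of_rat q" by (auto elim: Rats_cases)
  hence "z = of_rat q" using * by (simp add: complex_eq_iff of_rat_complex_eq)
  thus "z \<in> \<rat>" by simp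
qed

lemma subfield_gaussian_rationals: "subfield gaussian_rationals complex_ring"
  by (rule complex_subfieldI) (auto simp: gaussian_rationals_def)

lemma Rats_subset_gaussian_rationals: "\<rat> \<subseteq> gaussian_rationals"
  by (auto simp: gaussian_rationals_def complex_Rats_iff)

lemma rat_basis_gaussian_rationals: "rat_basis gaussian_rationals [1, \<i>]"
proof -
  \<comment> \<open>\<open>C.Span\<close> grows by one line extension per list element. The span of
    the tail also yields independence, as 1 has nonzero real part.\<close>
  have span_i: "C.Span \<rat> [\<i>] = {z. Re z = 0 \<and> Im z \<in> \<rat>}"
  proof (intro Set.set_eqI iffI)
    fix z assume "z \<in> {z. Re z = 0 \<and> Im z \<in> \<rat>}"
    hence "of_real (Im z) \<in> (\<rat> :: complex set)" "z = of_real (Im z) * \<i> + 0"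
      by (auto simp: complex_Rats_iff complex_eq_iff)
    thus "z \<in> C.Span \<rat> [\<i>]" by (auto simp: C.line_extension_mem_iff)
  qed (auto simp: C.line_extension_mem_iff complex_Rats_iff)
  have "C.Span \<rat> [1, \<i>] = C.line_extension \<rat> 1 (C.Span \<rat> [\<i>])" by simp
  also have "\<dots> = gaussian_rationals"
  proof (intro Set.set_eqI iffI)
    fix z assume "z \<in> gaussian_rationals"
    hence "of_real (Re z) \<in> (\<rat> :: complex set)" "\<i> * of_real (Im z) \<in> C.Span \<rat> [\<i>]"
      unfolding span_i by (auto simp: gaussian_rationals_def complex_Rats_iff)
    moreover have "z = of_real (Re z) * 1 + \<i> * of_real (Im z)" by (simp add: complex_eq_iff)
    ultimately show "z \<in> C.line_extension \<rat> 1 (C.Span \<rat> [\<i>])"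
      unfolding C.line_extension_mem_iff complex_ring_simps by blast
  next
    fix z assume "z \<in> C.line_extension \<rat> 1 (C.Span \<rat> [\<i>])"
    thus "z \<in> gaussian_rationals"
      unfolding C.line_extension_mem_iff span_i complex_ring_simps
      by (auto simp: gaussian_rationals_def complex_Rats_iff)
  qed
  finally have span: "C.Span \<rat> [1, \<i>] = gaussian_rationals" .
  have "C.independent \<rat> [\<i>]" by (rule C.li_Cons) auto
  hence "C.independent \<rat> [1, \<i>]" 
    by (rule C.li_Cons[rotated 2]) (auto simp: span_i simp del: C.Span.simps)
  with span show ?thesis by (auto simp: rat_basis_def gaussian_rationals_def simp del: C.Span.simps)
qed

text \<open>Multiplication by a + bi has trace 2a and determinant a^2 + b^2. A monic integer
  quadratic with a given nonreal root is unique, as required by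
  \<open>field_char_poly_eqI\<close>.\<close>

lemma field_char_poly_gaussian:
  assumes st: "2 * Re \<theta> = of_int s" "(Re \<theta>)\<^sup>2 + (Im \<theta>)\<^sup>2 = of_int t"
    and nonreal: "Im \<theta> \<noteq> 0" and mem: "\<theta> \<in> gaussian_rationals"
  shows "field_char_poly gaussian_rationals \<theta> = [:t, - s, 1:]"
proof -
  from mem obtain a b where ab: "Re \<theta> = of_rat a" "Im \<theta> = of_rat b"
    by (auto simp: gaussian_rationals_def elim!: Rats_cases)
  \<comment> \<open>Columns: the coordinates of \<theta> and of \<theta> * \<i> = - b + a * \<i> in
    the basis 1, \<i>.\<close>
  define M :: "rat mat" where "M = mat_of_rows_list 2 [[a, - b], [b, a]]"
  have "of_rat (2 * a) = (of_rat (of_int s) :: real)"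
    using st(1) ab by (simp add: of_rat_mult)
  hence s: "2 * a = of_int s" by (simp only: of_rat_eq_iff)
  have "of_rat (a * a + b * b) = (of_rat (of_int t) :: real)"
    using st(2) ab by (simp add: of_rat_mult of_rat_add power2_eq_square)
  hence t: "a * a + b * b = of_int t" by (simp only: of_rat_eq_iff)
  show ?thesis
  proof (rule field_char_poly_eqI[OF rat_basis_gaussian_rationals])
    have \<theta>: "\<theta> = of_rat a + of_rat b * \<i>"
      using ab by (simp add: complex_eq_iff of_rat_complex_eq)
    show "is_mult_matrix [1, \<i>] \<theta> M"
      unfolding is_mult_matrix_def M_def \<theta>
      by (auto simp: mat_of_rows_list_def less_Suc_eq numeral_2_eq_2 of_rat_minus algebra_simps)
    have "char_poly M = [:a * a + b * b, - (2 * a), 1:]"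
      unfolding char_poly_defs M_def
      by (subst det_2) (auto simp: mat_of_rows_list_def)
    thus "map_poly of_int [:t, - s, 1:] = char_poly M" by (simp add: s t)
  next
    fix G :: "int poly"
    assume G: "lead_coeff G = 1" "degree G = length [1, \<i>]" "poly (map_poly of_int G) \<theta> = 0"
    have "G = [:coeff G 0, coeff G 1, 1:]"
      using G by (intro poly_eqI)
        (auto simp: coeff_pCons coeff_eq_0 numeral_2_eq_2 split: nat.splits)
    then obtain u v where uv: "G = [:u, v, 1:]" by blast
    have eq: "of_int u + \<theta> * (of_int v + \<theta>) = 0" using G(3) by (simp add: uv)
    have "Im \<theta> * (of_int v + 2 * Re \<theta>) = 0"
      using arg_cong[OF eq, of Im] by (simp add: algebra_simps)
    hence v: "2 * Re \<theta> = - of_int v" using nonreal by simp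
    have v': "v = - s" using v st(1) by linarith
    have "of_int u + Re \<theta> * (of_int v + Re \<theta>) - Im \<theta> * Im \<theta> = 0"
      using arg_cong[OF eq, of Re] by simp
    moreover have "of_int v = - 2 * Re \<theta>" using v by simp
    ultimately have "of_int u = (Re \<theta>)\<^sup>2 + (Im \<theta>)\<^sup>2"
      by (simp add: power2_eq_square algebra_simps)
    hence "u = t" using st(2) by simp
    with v' show "G = [:t, - s, 1:]" by (simp add: uv)
  qed simp
qed

section \<open>Indices in the Gaussian field and congruence modulo 3\<close>

lemma int_index_gaussian_dvd_2:
  assumes "\<theta> \<in> ring_of_integers gaussian_rationals" "Im \<theta> \<noteq> 0"
  shows "int_index gaussian_rationals \<theta> dvd 2"
proof -
  let ?F = "poly (field_char_poly gaussian_rationals \<theta>)"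
  from assms obtain s t :: int
    where st: "2 * Re \<theta> = of_int s" "(Re \<theta>)\<^sup>2 + (Im \<theta>)\<^sup>2 = of_int t"
    by (auto simp: ring_of_integers_def gaussian_rationals_def
        elim!: algebraic_int_nonreal_quadratic)
  have "int_index gaussian_rationals \<theta> dvd ?F x" for x
    unfolding int_index_def by (rule Gcd_dvd) auto
  \<comment> \<open>The second difference at 0, 1, 2, in which the trace and norm coefficients
    cancel.\<close>
  hence "int_index gaussian_rationals \<theta> dvd ?F 0 - ?F 1 - (?F 1 - ?F 2)"
    by (intro dvd_diff)
  also have "?F 0 - ?F 1 - (?F 1 - ?F 2) = 2"
    using assms by (simp add: field_char_poly_gaussian[OF st] ring_of_integers_def)
  finally show ?thesis .
qed

text \<open>A real element of Q(i) is rational, so the field it generates is contained in the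
  rationals and misses \<i>.\<close>

lemma primitive_integers_gaussian_nonreal:
  assumes "\<theta> \<in> primitive_integers gaussian_rationals"
  shows "Im \<theta> \<noteq> 0"
proof
  assume "Im \<theta> = 0"
  with assms have "\<theta> \<in> \<rat>" and
    gen: "generate_field complex_ring (insert \<theta> \<rat>) = gaussian_rationals"
    by (auto simp: primitive_integers_def ring_of_integers_def gaussian_rationals_def
        complex_Rats_iff)
  hence "gaussian_rationals \<subseteq> \<rat>"
    using field.generate_field_min_subfield1[OF field_from_type_algebra, of "insert \<theta> \<rat>" \<rat>]
      subfield_Rats by auto
  moreover have "\<i> \<in> gaussian_rationals" by (simp add: gaussian_rationals_def)
  ultimately show False by (auto simp: complex_Rats_iff)
qed

lemma field_index_gaussian_dvd_2: "field_index gaussian_rationals dvd 2"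
  unfolding field_index_def
  by (rule Lcm_least)
    (auto simp: primitive_integers_def
      intro!: int_index_gaussian_dvd_2 primitive_integers_gaussian_nonreal)

lemma ii_not_cong_rational_integer_mod_3:
  assumes "\<alpha> \<in> ring_of_integers \<rat>"
  shows "\<not> cong_integers gaussian_rationals 3 \<i> \<alpha>"
proof
  assume "cong_integers gaussian_rationals 3 \<i> \<alpha>"
  then obtain \<gamma> where \<gamma>: "\<gamma> \<in> ring_of_integers gaussian_rationals" "\<i> - \<alpha> = 3 * \<gamma>"
    by (auto simp: cong_integers_def)
  from assms obtain n where n: "\<alpha> = of_int n"
    using rational_algebraic_int_is_int[of \<alpha>] by (auto simp: ring_of_integers_def elim: Ints_cases)
  have re: "Re \<gamma> = - of_int n / 3" and im: "Im \<gamma> = 1 / 3"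
    using arg_cong[OF \<gamma>(2), of Re] arg_cong[OF \<gamma>(2), of Im] by (auto simp: n)
  have \<gamma>_int: "algebraic_int \<gamma>" and rat: "Re \<gamma> \<in> \<rat>" "Im \<gamma> \<in> \<rat>"
    using \<gamma>(1) by (simp_all add: ring_of_integers_def gaussian_rationals_def)
  have "Im \<gamma> \<noteq> 0" unfolding im by simp
  from \<gamma>_int this rat obtain s t :: int
    where "2 * Re \<gamma> = of_int s" "(Re \<gamma>)\<^sup>2 + (Im \<gamma>)\<^sup>2 = of_int t"
    by (rule algebraic_int_nonreal_quadratic)
  \<comment> \<open>The integer \<open>t\<close> is the norm of \<gamma>, which equals (n^2 + 1) /
    9.\<close>
  hence "of_int (n * n + 1) = (of_int (9 * t) :: real)"
    unfolding re im by (simp add: power2_eq_square field_simps)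
  hence "n * n + 1 = 9 * t" by (simp only: of_int_eq_iff)
  hence "(n * n + 1) mod 3 = 0" by simp
  \<comment> \<open>Squares are 0 or 1 modulo 3, so n^2 + 1 is 1 or 2.\<close>
  moreover have "n mod 3 = 0 \<or> n mod 3 = 1 \<or> n mod 3 = 2" by presburger
  hence "(n * n + 1) mod 3 \<noteq> 0"
    by (auto simp flip: mod_add_left_eq[of "n * n"] mod_mult_eq[of n 3 n])
  ultimately show False by simp
qed

theorem mainTheorem8:
  shows "\<exists>(K\<^sub>1 :: complex set) (K :: complex set) (p :: nat).
    number_field K\<^sub>1 \<and> number_field K \<and> K\<^sub>1 \<subseteq> K \<and> Factorial_Ring.prime p \<and>
    \<not> (index_power_condition K\<^sub>1 K p \<longleftrightarrow> index_cong_condition K\<^sub>1 K p)"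
proof (intro exI conjI)
  show "number_field \<rat>"
    using rat_basis_imp_number_field[OF subfield_Rats rat_basis_Rats] .
  show "number_field gaussian_rationals"
    using rat_basis_imp_number_field[OF subfield_gaussian_rationals rat_basis_gaussian_rationals] .
  show "\<rat> \<subseteq> gaussian_rationals" by (rule Rats_subset_gaussian_rationals)
  show "Factorial_Ring.prime (3 :: nat)" by simp
  \<comment> \<open>Every index involved divides 2, so this one fact makes both sides of (1) zero
    and verifies the hypothesis of (2) at \<i>.\<close>
  have mult: "multiplicity (int 3) n = 0" if "n dvd 2" for n :: int
    using that by (intro not_dvd_imp_multiplicity_0) (auto dest: dvd_trans)
  have "index_power_condition \<rat> gaussian_rationals 3"
    using mult[OF field_index_gaussian_dvd_2] mult[of "field_index \<rat>"]
      dvd_trans[OF field_index_Rats_dvd]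
    by (simp add: index_power_condition_def)
  moreover have "\<i> \<in> ring_of_integers gaussian_rationals"
    by (simp add: ring_of_integers_def gaussian_rationals_def)
  hence "\<not> index_cong_condition \<rat> gaussian_rationals 3"
    using ii_not_cong_rational_integer_mod_3 mult[OF field_index_gaussian_dvd_2]
      mult[OF int_index_gaussian_dvd_2[of \<i>]]
    unfolding index_cong_condition_def by auto
  ultimately show "\<not> (index_power_condition \<rat> gaussian_rationals 3 \<longleftrightarrow>
      index_cong_condition \<rat> gaussian_rationals 3)" by simp
qed

end
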